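(* Let $n\ge2$, $\alpha>0$, $0<m<3$, and let $h\in C(B_1)\cap L^\infty(B_1)$ with $h\le 0$. Let $u\in C(B_1)\cap L^\infty(B_1)$ be a nonnegative viscosity solution of \[ \Delta_\infty u=|x|^\alpha u^m+h(x)\quad\text{in }B_1, \] and assume that $0\in\partial\{u>0\}$. Then there exists a constant $C>0$, depending only on $\alpha$, $m$, $\|u\|_{L^\infty(B_1)}$ and the dimension $n$, such that \[ \sup_{x\in B_r(0)}u(x)\le C\, r^{\frac{4+\alpha}{3-m}}\qquad\text{for every }0<r<1/3 . \] In particular, $u$ is differentiable at the origin and $Du(0)=0$.
   Context: $B_r(x_0)$ is the open ball in $\mathbb{R}^n$ of radius $r$ centered at $x_0$, and $B_r=B_r(0)$. The infinity Laplacian is $\Delta_\infty w=\langle D^2w\,Dw,Dw\rangle=\sum_{i,j}\partial_i w\,\partial_{ij}w\,\partial_j w$. Write $t_+=\max\{t,0\}$ (so $u^m=u_+^m$ for nonnegative $u$). A function $u\in C(B_1)$ is a viscosity subsolution (resp. supersolution) of $\Delta_\infty u=|x|^\alpha u_+^m+h(x)$ in $B_1$ if, whenever $\varphi\in C^2(B_1)$ and $u-\varphi$ has a local maximum (resp. minimum) at $x_0\in B_1$, one has $\Delta_\infty\varphi(x_0)\ge|x_0|^\alpha(u(x_0)_+)^m+h(x_0)$ (resp. $\le$). It is a viscosity solution if it is both. $\{u>0\}=\{x\in B_1:u(x)>0\}$. *)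

theory Defs
  imports "HOL-Analysis.Analysis" "HOL-Probability.Essential_Supremum"
begin

definition partial_deriv :: "'n \<Rightarrow> (real ^ 'n::finite \<Rightarrow> real) \<Rightarrow> real ^ 'n \<Rightarrow> real" where
  "partial_deriv i f x = frechet_derivative f (at x) (axis i 1)"

text \<open>
  Intended for open \<open>S\<close>. Continuity of \<open>f\<close> and of its first partial derivatives is implied by
  their differentiability.
\<close>

definition C2_on :: "(real ^ 'n::finite) set \<Rightarrow> (real ^ 'n \<Rightarrow> real) \<Rightarrow> bool" where
  "C2_on S f \<longleftrightarrow>
     f differentiable_on S \<and>
     (\<forall>i. partial_deriv i f differentiable_on S) \<and>
     (\<forall>i j. continuous_on S (partial_deriv i (partial_deriv j f)))"

definition infinity_laplacian :: "(real ^ 'n::finite \<Rightarrow> real) \<Rightarrow> real ^ 'n \<Rightarrow> real" where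
  "infinity_laplacian w x =
     (\<Sum>i\<in>UNIV. \<Sum>j\<in>UNIV.
        partial_deriv i w x * partial_deriv i (partial_deriv j w) x * partial_deriv j w x)"

definition local_max_in :: "'a::topological_space set \<Rightarrow> ('a \<Rightarrow> real) \<Rightarrow> 'a \<Rightarrow> bool" where
  "local_max_in S f x0 \<longleftrightarrow> (\<forall>\<^sub>F x in at x0 within S. f x \<le> f x0)"

definition local_min_in :: "'a::topological_space set \<Rightarrow> ('a \<Rightarrow> real) \<Rightarrow> 'a \<Rightarrow> bool" where
  "local_min_in S f x0 \<longleftrightarrow> (\<forall>\<^sub>F x in at x0 within S. f x \<ge> f x0)"

text \<open>
  Viscosity sub- and supersolutions in \<open>S\<close> of the equation
  \<open>infinity_laplacian u x = F x (u x)\<close>.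
\<close>

definition viscosity_subsolution ::
  "(real ^ 'n::finite) set \<Rightarrow> (real ^ 'n \<Rightarrow> real \<Rightarrow> real) \<Rightarrow> (real ^ 'n \<Rightarrow> real) \<Rightarrow> bool" where
  "viscosity_subsolution S F u \<longleftrightarrow>
     continuous_on S u \<and>
     (\<forall>\<phi> x0. C2_on S \<phi> \<and> x0 \<in> S \<and> local_max_in S (\<lambda>x. u x - \<phi> x) x0
        \<longrightarrow> infinity_laplacian \<phi> x0 \<ge> F x0 (u x0))"

definition viscosity_supersolution ::
  "(real ^ 'n::finite) set \<Rightarrow> (real ^ 'n \<Rightarrow> real \<Rightarrow> real) \<Rightarrow> (real ^ 'n \<Rightarrow> real) \<Rightarrow> bool" where
  "viscosity_supersolution S F u \<longleftrightarrow>
     continuous_on S u \<and>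
     (\<forall>\<phi> x0. C2_on S \<phi> \<and> x0 \<in> S \<and> local_min_in S (\<lambda>x. u x - \<phi> x) x0
        \<longrightarrow> infinity_laplacian \<phi> x0 \<le> F x0 (u x0))"

definition viscosity_solution ::
  "(real ^ 'n::finite) set \<Rightarrow> (real ^ 'n \<Rightarrow> real \<Rightarrow> real) \<Rightarrow> (real ^ 'n \<Rightarrow> real) \<Rightarrow> bool" where
  "viscosity_solution S F u \<longleftrightarrow> viscosity_subsolution S F u \<and> viscosity_supersolution S F u"

text \<open>
  The norm of \<open>L\<^sup>\<infinity>(S)\<close> as an extended real; \<open>esssup\<close> is \<open>\<infinity>\<close> on non-measurable functions, so
  finiteness of this quantity is membership in \<open>L\<^sup>\<infinity>(S)\<close>.
\<close>

definition Linf_norm :: "(real ^ 'n::finite) set \<Rightarrow> (real ^ 'n \<Rightarrow> real) \<Rightarrow> ereal" where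
  "Linf_norm S f = esssup (lebesgue_on S) (\<lambda>x. ereal \<bar>f x\<bar>)"

end

theory Submission
  imports Defs
begin

text \<open>
  Only three facts about \<open>u\<close> enter: it is a nonnegative viscosity supersolution of
  \<open>\<Delta>\<^sub>\<infinity> u \<le> \<bar>x\<bar>\<^sup>\<alpha> u\<^sup>m\<close> (because \<open>h \<le> 0\<close>), it is bounded by \<open>M\<close>, and \<open>u 0 = 0\<close>.

  The heart is a quantitative minimum principle (\<open>supersolution_cone_bound\<close>). If
  \<open>\<Delta>\<^sub>\<infinity> u \<le> K\<close> and \<open>u \<ge> 0\<close> on the closed ball of radius \<open>L\<close> about \<open>y\<close>, and \<open>u\<close> vanishes
  somewhere in the open ball, then \<open>u y ^ 3 \<le> (27/8) L ^ 4 K\<close>. To see this when \<open>u y > 0\<close>,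
  compare \<open>u\<close> with a slightly convex cone \<open>g (\<rho>) = u y - b \<rho> + c \<rho>\<^sup>2\<close> with vertex at \<open>y\<close>, where \<open>g\<close> is positive on \<open>[0, L)\<close>
  and \<open>g (L) = 0\<close>. Since the cone is positive at the zero of \<open>u\<close>, the minimum of \<open>u\<close> minus the cone is
  negative, hence attained neither at \<open>y\<close> nor on the sphere. At such a point the supersolution
  property gives \<open>g'\<^sup>2 g'' \<le> K\<close>. With \<open>b = 4 u y / (3 L)\<close> and \<open>c = b / (4 L)\<close> the left-hand side
  is at least \<open>b ^ 3 / (8 L) = (8/27) u y ^ 3 / L ^ 4\<close>, which is the claim.

  Apply this with \<open>\<bar>y\<bar> < r\<close> and \<open>L = 2 r\<close>. With \<open>S (r)\<close> the supremum of \<open>u\<close> over the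
  ball of radius \<open>r\<close> about the origin,
  \<open>S (r) ^ 3 \<le> 54 r ^ 4 (3 r)\<^sup>\<alpha> S (3 r)\<^sup>m\<close>. The exponent \<open>\<beta> = (4 + \<alpha>) / (3 - m)\<close> is the one
  fixed by this scaling, and as \<open>m < 3\<close>, a bound \<open>S (3 r) \<le> A (3 r)\<^sup>\<beta>\<close> with \<open>A\<close> large reproduces
  itself at radius \<open>r\<close> (\<open>growth_iteration\<close>). Differentiability follows from \<open>\<beta> > 1\<close>.
\<close>

section \<open>Radial test functions\<close>

lemma partial_deriv_eqI:
  assumes "(f has_derivative D) (at x)"
  shows "partial_deriv i f x = D (axis i 1)"
  using frechet_derivative_at[OF assms] by (simp add: partial_deriv_def)

text \<open>
  Writing the radial function in terms of the squared distance keeps it twice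
  continuously differentiable at the centre.
\<close>

lemma
  fixes y :: "real ^ 'n::finite" and p p' p'' :: "real \<Rightarrow> real"
  assumes p: "\<And>s. (p has_real_derivative p' s) (at s)"
    and p': "\<And>s. (p' has_real_derivative p'' s) (at s)"
    and cont: "continuous_on UNIV p''"
  shows C2_on_radial: "C2_on S (\<lambda>x. p ((norm (x - y))\<^sup>2))"
    and infinity_laplacian_radial:
      "infinity_laplacian (\<lambda>x. p ((norm (x - y))\<^sup>2)) x =
        8 * (p' ((norm (x - y))\<^sup>2))\<^sup>2 * (norm (x - y))\<^sup>2 *
        (2 * p'' ((norm (x - y))\<^sup>2) * (norm (x - y))\<^sup>2 + p' ((norm (x - y))\<^sup>2))"
proof -
  define \<sigma> where "\<sigma> x = (norm (x - y))\<^sup>2" for x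
  define Q where "Q x = p (\<sigma> x)" for x
  have \<sigma>: "(\<sigma> has_derivative (\<lambda>v. 2 * ((x - y) \<bullet> v))) (at x)" for x
    unfolding \<sigma>_def power2_norm_eq_inner
    by (auto intro!: derivative_eq_intros simp: inner_commute)
  have comp: "((\<lambda>x. f (\<sigma> x)) has_derivative (\<lambda>v. 2 * ((x - y) \<bullet> v) * f' (\<sigma> x))) (at x)"
    if "\<And>s. (f has_real_derivative f' s) (at s)" for f f' x
    using has_derivative_compose[OF \<sigma> that[unfolded has_field_derivative_def]]
    by (simp add: mult.commute)
  have Q: "(Q has_derivative (\<lambda>v. 2 * ((x - y) \<bullet> v) * p' (\<sigma> x))) (at x)" for x
    unfolding Q_def by (rule comp[OF p])
  have dQ: "partial_deriv i Q = (\<lambda>x. 2 * (x - y) $ i * p' (\<sigma> x))" for i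
    by (rule ext) (simp add: partial_deriv_eqI[OF Q] inner_axis)
  have Qi: "(partial_deriv i Q has_derivative
      (\<lambda>v. 2 * (x - y) $ i * (2 * ((x - y) \<bullet> v) * p'' (\<sigma> x)) + 2 * v $ i * p' (\<sigma> x))) (at x)" for i x
  proof -
    have "((\<lambda>x. (x - y) $ i) has_derivative (\<lambda>v. (v - 0) $ i)) (at x)"
      by (intro bounded_linear.has_derivative[OF bounded_linear_vec_nth]
          has_derivative_diff has_derivative_ident has_derivative_const)
    then have "((\<lambda>x. (x - y) $ i) has_derivative (\<lambda>v. v $ i)) (at x)" by simp
    then have "((\<lambda>x. 2 * (x - y) $ i) has_derivative (\<lambda>v. 2 * v $ i)) (at x)"
      by (rule has_derivative_mult_right)
    from has_derivative_mult[OF this comp[OF p']] show ?thesis unfolding dQ .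
  qed
  have ax: "axis i (1::real) $ j = (if i = j then 1 else 0)" for i j :: 'n
    by (simp add: axis_def)
  have ddQ: "partial_deriv i (partial_deriv j Q) =
      (\<lambda>x. 4 * (x - y) $ i * (x - y) $ j * p'' (\<sigma> x) + 2 * (if i = j then 1 else 0) * p' (\<sigma> x))" for i j
    by (rule ext) (auto simp: partial_deriv_eqI[OF Qi] inner_axis ax algebra_simps)
  have cp': "continuous_on UNIV p'"
    using p' by (meson DERIV_isCont continuous_at_imp_continuous_on)
  have c\<sigma>: "continuous_on S \<sigma>"
    unfolding \<sigma>_def by (intro continuous_intros)
  have "C2_on S Q"
    unfolding C2_on_def
  proof (intro conjI allI)
    show "Q differentiable_on S"
      using Q by (meson differentiable_def differentiable_at_withinI differentiable_on_def)
    show "partial_deriv i Q differentiable_on S" for i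
      using Qi by (meson differentiable_def differentiable_at_withinI differentiable_on_def)
    show "continuous_on S (partial_deriv i (partial_deriv j Q))" for i j
      unfolding ddQ
      by (intro continuous_intros continuous_on_compose2[OF cp' c\<sigma>] continuous_on_compose2[OF cont c\<sigma>]) auto
  qed
  then show "C2_on S (\<lambda>x. p ((norm (x - y))\<^sup>2))"
    by (simp add: Q_def[abs_def] \<sigma>_def)
  have ss: "(\<Sum>i\<in>UNIV. ((x - y) $ i)\<^sup>2) = \<sigma> x"
    unfolding \<sigma>_def power2_norm_eq_inner inner_vec_def by (simp add: power2_eq_square)
  let ?a = "p' (\<sigma> x)" and ?b = "p'' (\<sigma> x)"
  have "infinity_laplacian Q x = (\<Sum>i\<in>UNIV. \<Sum>j\<in>UNIV.
      16 * ?a\<^sup>2 * ?b * (((x - y) $ i)\<^sup>2 * ((x - y) $ j)\<^sup>2) + (if i = j then 8 * ?a ^ 3 * ((x - y) $ i)\<^sup>2 else 0))"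
    unfolding infinity_laplacian_def ddQ
    by (intro sum.cong refl) (auto simp: dQ power2_eq_square power3_eq_cube algebra_simps)
  also have "\<dots> = 16 * ?a\<^sup>2 * ?b * (\<sigma> x * \<sigma> x) + 8 * ?a ^ 3 * \<sigma> x"
    by (simp add: sum.distrib sum_distrib_left[symmetric] sum_distrib_right[symmetric] ss[simplified])
  also have "\<dots> = 8 * ?a\<^sup>2 * \<sigma> x * (2 * ?b * \<sigma> x + ?a)"
    by (simp add: power2_eq_square power3_eq_cube algebra_simps)
  finally show "infinity_laplacian (\<lambda>x. p ((norm (x - y))\<^sup>2)) x =
        8 * (p' ((norm (x - y))\<^sup>2))\<^sup>2 * (norm (x - y))\<^sup>2 *
        (2 * p'' ((norm (x - y))\<^sup>2) * (norm (x - y))\<^sup>2 + p' ((norm (x - y))\<^sup>2))"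
    by (simp add: Q_def[abs_def] \<sigma>_def)
qed

section \<open>The minimum principle\<close>

text \<open>
  In \<open>\<tau> = t\<^sup>2\<close> the left-hand side is the third-order Taylor polynomial of \<open>- sqrt \<tau>\<close> at \<open>1\<close>.
  The second-order one would lie above \<open>- sqrt \<tau>\<close> for \<open>\<tau> > 1\<close>; the cubic term makes the bound global
  without changing the second derivative at the contact point.
\<close>

lemma neg_sqrt_ge_cubic:
  fixes t :: real
  assumes "0 \<le> t"
  shows "- 1 - (t\<^sup>2 - 1) / 2 + (t\<^sup>2 - 1)\<^sup>2 / 8 - (t\<^sup>2 - 1) ^ 3 / 16 \<le> - t"
proof -
  have "- t - (- 1 - (t\<^sup>2 - 1) / 2 + (t\<^sup>2 - 1)\<^sup>2 / 8 - (t\<^sup>2 - 1) ^ 3 / 16) = (t - 1) ^ 4 * (t\<^sup>2 + 4 * t + 5) / 16"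
    by (simp add: field_simps eval_nat_numeral)
  also have "\<dots> \<ge> 0"
    using assms by (intro divide_nonneg_pos mult_nonneg_nonneg) auto
  finally show ?thesis by simp
qed

text \<open>
  The vertex of the cone has to be singular, because only the value of \<open>u\<close> at \<open>y\<close> is prescribed.
  As test functions must be smooth on all of \<open>S\<close>, the cone is replaced at the contact point by
  a function of the squared distance that touches it from below to second order.
\<close>

lemma supersolution_cone_bound:
  fixes u :: "real ^ 'n::finite \<Rightarrow> real"
  assumes super: "viscosity_supersolution S F u"
    and sub: "cball y L \<subseteq> S" and L: "0 < L"
    and nonneg: "\<And>x. x \<in> cball y L \<Longrightarrow> 0 \<le> u x"
    and x0: "x0 \<in> ball y L" "u x0 = 0"
    and F: "\<And>z. z \<in> ball y L \<Longrightarrow> F z (u z) \<le> K"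
    and K: "0 \<le> K"
  shows "u y ^ 3 \<le> 27 / 8 * L ^ 4 * K"
proof (cases "u y = 0")
  case True
  then show ?thesis using K L by simp
next
  case False
  then have uy: "0 < u y" using nonneg[of y] L by simp
  \<comment> \<open>The choice of \<open>c\<close> keeps the slope of \<open>g\<close> at most \<open>- b / 2\<close> on \<open>[0, L]\<close>; that of \<open>b\<close> makes \<open>g L = 0\<close>.\<close>
  define b where "b = 4 * u y / (3 * L)"
  define c where "c = b / (4 * L)"
  have b: "0 < b" and c: "0 < c" using uy L by (auto simp: b_def c_def)
  have uyb: "u y = 3 * b * L / 4" using L by (simp add: b_def)
  define g where "g \<rho> = u y - b * \<rho> + c * \<rho>\<^sup>2" for \<rho>
  have gL: "g L = 0" using L by (simp add: g_def uyb c_def field_simps power2_eq_square)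
  have gfac: "g \<rho> = (L - \<rho>) * (3 * b / 4 - c * \<rho>)" for \<rho>
    using L by (simp add: g_def uyb c_def field_simps power2_eq_square)
  have gpos: "0 < g \<rho>" if "0 \<le> \<rho>" "\<rho> < L" for \<rho>
  proof -
    have "c * \<rho> \<le> c * L" using that c by simp
    also have "c * L = b / 4" using L by (simp add: c_def)
    finally have "0 < 3 * b / 4 - c * \<rho>" using b by simp
    then show ?thesis unfolding gfac using that by simp
  qed
  let ?w = "\<lambda>x. u x - g (norm (x - y))"
  have "continuous_on (cball y L) ?w"
    using super sub unfolding viscosity_supersolution_def g_def
    by (auto intro!: continuous_intros intro: continuous_on_subset)
  then obtain z where z: "z \<in> cball y L" and zmin: "\<And>x. x \<in> cball y L \<Longrightarrow> ?w z \<le> ?w x"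
    using continuous_attains_inf[of "cball y L" ?w] L by auto
  have "?w z \<le> ?w x0" using x0 by (intro zmin) auto
  also have "\<dots> < 0" using gpos[of "norm (x0 - y)"] x0 by (simp add: dist_norm norm_minus_commute)
  finally have neg: "?w z < 0" .
  have "z \<noteq> y" using neg by (auto simp: g_def)
  moreover have "dist y z \<noteq> L"
    using neg nonneg[OF z] gL by (auto simp: dist_norm norm_minus_commute)
  ultimately have zb: "z \<in> ball y L" and zy: "z \<noteq> y" using z by auto
  define R where "R = norm (z - y)"
  have R: "0 < R" "R < L" using zb zy by (auto simp: R_def dist_norm norm_minus_commute)
  \<comment> \<open>\<open>p\<close>, as a function of \<open>s = \<rho>\<^sup>2\<close>, is \<open>g\<close> with \<open>- \<rho>\<close> replaced by its cubic minorant at \<open>\<rho> = R\<close>.\<close>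
  define p where "p s = u y + c * s + b * R *
    (- 1 - (s / R\<^sup>2 - 1) / 2 + (s / R\<^sup>2 - 1)\<^sup>2 / 8 - (s / R\<^sup>2 - 1) ^ 3 / 16)" for s
  define p' where "p' s = c + b / R *
    (- 1 / 2 + (s / R\<^sup>2 - 1) / 4 - 3 * (s / R\<^sup>2 - 1)\<^sup>2 / 16)" for s
  define p'' where "p'' s = b / R ^ 3 * (1 / 4 - 3 * (s / R\<^sup>2 - 1) / 8)" for s
  have dp: "(p has_real_derivative p' s) (at s)" for s
    unfolding p_def p'_def using R
    by (auto intro!: derivative_eq_intros simp: field_simps eval_nat_numeral)
  have dp': "(p' has_real_derivative p'' s) (at s)" for s
    unfolding p'_def p''_def using R
    by (auto intro!: derivative_eq_intros simp: field_simps eval_nat_numeral)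
  have cp: "continuous_on UNIV p''"
    unfolding p''_def by (intro continuous_intros) (use R in auto)
  let ?\<phi> = "\<lambda>x. p ((norm (x - y))\<^sup>2)"
  have pg: "p (\<rho>\<^sup>2) \<le> g \<rho>" if "0 \<le> \<rho>" for \<rho>
  proof -
    have "b * R * (- 1 - (\<rho>\<^sup>2 / R\<^sup>2 - 1) / 2 + (\<rho>\<^sup>2 / R\<^sup>2 - 1)\<^sup>2 / 8 - (\<rho>\<^sup>2 / R\<^sup>2 - 1) ^ 3 / 16)
        \<le> b * R * (- (\<rho> / R))"
      using neg_sqrt_ge_cubic[of "\<rho> / R"] that b R
      by (intro mult_left_mono) (auto simp: power_divide)
    also have "\<dots> = - (b * \<rho>)" using R by simp
    finally show ?thesis by (simp add: p_def g_def)
  qed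
  have pz: "p (R\<^sup>2) = g R" using R by (simp add: p_def g_def)
  have "eventually (\<lambda>x. x \<in> ball y L) (at z within S)"
    using zb by (intro eventually_at_topological[THEN iffD2] exI[of _ "ball y L"]) auto
  then have "local_min_in S (\<lambda>x. u x - ?\<phi> x) z"
    unfolding local_min_in_def
  proof eventually_elim
    case (elim x)
    then have "?w z \<le> ?w x" by (intro zmin) auto
    then show ?case using pg[of "norm (x - y)"] pz by (simp add: R_def)
  qed
  then have "infinity_laplacian ?\<phi> z \<le> F z (u z)"
    using super C2_on_radial[OF dp dp' cp] sub z unfolding viscosity_supersolution_def by blast
  also have "\<dots> \<le> K" by (rule F[OF zb])
  finally have "infinity_laplacian ?\<phi> z \<le> K" .
  also have "infinity_laplacian ?\<phi> z = 2 * c * (b - 2 * c * R)\<^sup>2"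
    unfolding infinity_laplacian_radial[OF dp dp' cp] R_def[symmetric]
    using R by (simp add: p'_def p''_def field_simps eval_nat_numeral)
  finally have le: "2 * c * (b - 2 * c * R)\<^sup>2 \<le> K" .
  have "c * R \<le> c * L" using R c by simp
  also have "c * L = b / 4" using L by (simp add: c_def)
  finally have "(b / 2)\<^sup>2 \<le> (b - 2 * c * R)\<^sup>2" using b by (intro power_mono) auto
  then have "2 * c * (b / 2)\<^sup>2 \<le> 2 * c * (b - 2 * c * R)\<^sup>2"
    using c by (intro mult_left_mono) auto
  then have "2 * c * (b / 2)\<^sup>2 \<le> K" using le by (rule order_trans)
  then have "27 / 8 * L ^ 4 * (2 * c * (b / 2)\<^sup>2) \<le> 27 / 8 * L ^ 4 * K"
    using L by (intro mult_left_mono) auto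
  moreover have "u y ^ 3 = 27 / 8 * L ^ 4 * (2 * c * (b / 2)\<^sup>2)"
    using L by (simp add: uyb c_def field_simps eval_nat_numeral)
  ultimately show ?thesis by (simp only:)
qed

section \<open>Iteration over triadic radii\<close>

text \<open>
  The condition \<open>M * 3 powr \<beta> \<le> A\<close> starts the induction at radii in \<open>[1/3, 1)\<close>; the lower bound on
  \<open>A powr (3 - m)\<close> absorbs the constant \<open>D\<close> when passing from radius \<open>3 * r\<close> to \<open>r\<close>.
\<close>

lemma growth_iteration:
  fixes u :: "'a::real_normed_vector \<Rightarrow> real"
  assumes exps: "0 < \<alpha>" "0 < m" "m < 3"
  defines "\<beta> \<equiv> (4 + \<alpha>) / (3 - m)"
  assumes bound: "\<And>x. x \<in> ball 0 1 \<Longrightarrow> u x \<le> M"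
    and step: "\<And>r B x. \<lbrakk>0 < r; 3 * r < 1; 0 \<le> B; \<And>x. x \<in> ball 0 (3 * r) \<Longrightarrow> u x \<le> B; x \<in> ball 0 r\<rbrakk> \<Longrightarrow>
      u x ^ 3 \<le> D * r ^ 4 * ((3 * r) powr \<alpha> * B powr m)"
    and A: "0 < A" "M * 3 powr \<beta> \<le> A" "D * 3 powr (\<alpha> + \<beta> * m) \<le> A powr (3 - m)"
    and r: "0 < r" "r < 1" and x: "x \<in> ball 0 r"
  shows "u x \<le> A * r powr \<beta>"
proof -
  have \<beta>: "0 < \<beta>" using exps by (simp add: \<beta>_def)
  have *: "\<forall>x\<in>ball 0 r. u x \<le> A * r powr \<beta>" if "1 / 3 ^ Suc k \<le> r" "r < 1" for k r
    using that
  proof (induction k arbitrary: r)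
    case 0
    have "M \<le> A / 3 powr \<beta>" using A by (simp add: field_simps)
    also have "\<dots> = A * (1/3) powr \<beta>" by (simp add: powr_divide)
    also have "\<dots> \<le> A * r powr \<beta>"
      using 0 \<beta> A by (intro mult_left_mono powr_mono2) auto
    finally have "M \<le> A * r powr \<beta>" .
    moreover have "u x \<le> M" if "x \<in> ball 0 r" for x
      using that 0 by (intro bound) auto
    ultimately show ?case by force
  next
    case (Suc k)
    show ?case
    proof (cases "3 * r < 1")
      case False
      have "(3::real) ^ 1 \<le> 3 ^ Suc k" by (intro power_increasing) auto
      then have "1 / 3 ^ Suc k \<le> (1 / 3 :: real)" by (intro divide_left_mono) auto
      also have "\<dots> \<le> r" using False by simp
      finally show ?thesis using Suc.prems by (intro Suc.IH)
    next
      case True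
      have r0: "0 < r" by (rule less_le_trans[OF _ Suc.prems(1)]) simp
      define B where "B = A * (3 * r) powr \<beta>"
      have IH: "\<forall>x\<in>ball 0 (3 * r). u x \<le> B"
        unfolding B_def using True Suc.prems by (intro Suc.IH) (auto simp: field_simps)
      have B0: "0 \<le> B" using A by (simp add: B_def)
      show ?thesis
      proof
        fix x :: 'a assume x: "x \<in> ball 0 r"
        \<comment> \<open>The identity that determines \<open>\<beta>\<close>: both sides of the step scale alike in \<open>r\<close>.\<close>
        have e: "4 + \<alpha> + \<beta> * m = 3 * \<beta>" using exps by (simp add: \<beta>_def field_simps)
        have "u x ^ 3 \<le> D * r ^ 4 * ((3 * r) powr \<alpha> * B powr m)"
          using step[OF r0 True B0 _ x] IH by blast
        also have "r ^ 4 = r powr 4" using r0 by (simp add: powr_numeral)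
        also have "D * r powr 4 * ((3 * r) powr \<alpha> * B powr m)
          = (D * 3 powr (\<alpha> + \<beta> * m)) * A powr m * r powr (4 + \<alpha> + \<beta> * m)"
          using A r0 by (simp add: B_def powr_mult powr_powr powr_add)
        also have "\<dots> \<le> A powr (3 - m) * A powr m * r powr (4 + \<alpha> + \<beta> * m)"
          using A by (intro mult_right_mono) auto
        also have "\<dots> = (A powr 3) * r powr (\<beta> * 3)"
          using e by (simp add: powr_add[symmetric] mult.commute)
        also have "\<dots> = (A * r powr \<beta>) ^ 3"
          using A r0 by (simp add: powr_powr[symmetric] powr_numeral power_mult_distrib)
        finally have "u x ^ 3 \<le> (A * r powr \<beta>) ^ 3" .
        then show "u x \<le> A * r powr \<beta>"
          using A power_le_imp_le_base[of "u x" 2] by (simp add: eval_nat_numeral)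
      qed
    qed
  qed
  obtain k where "(1/3) ^ k < r"
    using real_arch_pow_inv[OF r(1), of "1/3"] by auto
  moreover have "1 / 3 ^ Suc k \<le> (1/3 :: real) ^ k"
    unfolding power_one_over by (intro divide_left_mono) auto
  ultimately have "1 / 3 ^ Suc k \<le> r" by linarith
  then show ?thesis using * r x by blast
qed

section \<open>Growth at a free boundary point\<close>

lemma le_Linf_norm_of_continuous:
  fixes u :: "real ^ 'n::finite \<Rightarrow> real"
  assumes S: "open S" and u: "continuous_on S u" and M: "Linf_norm S u = ereal M" and x: "x \<in> S"
  shows "\<bar>u x\<bar> \<le> M"
proof (rule ccontr)
  assume "\<not> \<bar>u x\<bar> \<le> M"
  define T where "T = S \<inter> (\<lambda>x. \<bar>u x\<bar>) -` {M<..}"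
  have cont: "continuous_on S (\<lambda>x. \<bar>u x\<bar>)" using u by (intro continuous_intros)
  then have T: "open T" unfolding T_def using S by (intro continuous_open_preimage) auto
  have "x \<in> T" using x \<open>\<not> \<bar>u x\<bar> \<le> M\<close> by (simp add: T_def)
  have "AE x in lebesgue_on S. ereal \<bar>u x\<bar> \<le> ereal M"
    using esssup_AE[of "\<lambda>x. ereal \<bar>u x\<bar>" "lebesgue_on S"] M by (simp add: Linf_norm_def)
  then have "AE x in lebesgue. x \<in> S \<longrightarrow> \<bar>u x\<bar> \<le> M"
    using S by (subst (asm) AE_restrict_space_iff) auto
  then have "AE x in lebesgue. x \<notin> T"
    by eventually_elim (auto simp: T_def)
  then have "negligible T"
    using T by (simp add: negligible_iff_null_sets AE_iff_null_sets)
  then show False using open_not_negligible[OF T] \<open>x \<in> T\<close> by auto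
qed

lemma has_derivative_zero_of_powr_bound:
  fixes u :: "'a::real_normed_vector \<Rightarrow> real"
  assumes u0: "u 0 = 0" and \<beta>: "1 < \<beta>" and \<delta>: "0 < \<delta>"
    and bound: "\<And>x. norm x < \<delta> \<Longrightarrow> \<bar>u x\<bar> \<le> C * norm x powr \<beta>"
  shows "(u has_derivative (\<lambda>_. 0)) (at 0)"
  unfolding has_derivative_at
proof (intro conjI)
  have "((\<lambda>x::'a. norm x) \<longlongrightarrow> 0) (at 0)"
    using tendsto_norm[OF tendsto_ident_at, of "0::'a" UNIV] by simp
  then have "((\<lambda>x::'a. norm x powr (\<beta> - 1)) \<longlongrightarrow> 0 powr (\<beta> - 1)) (at 0)"
    using \<beta> by (intro tendsto_powr' tendsto_const) auto
  then have lim: "((\<lambda>x::'a. C * norm x powr (\<beta> - 1)) \<longlongrightarrow> 0) (at 0)"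
    using tendsto_mult_right_zero by auto
  have "eventually (\<lambda>x. x \<in> ball (0::'a) \<delta>) (at 0)"
    using \<delta> by (intro eventually_at_in_open') auto
  then have "eventually (\<lambda>x::'a. norm (u x / norm x) \<le> C * norm x powr (\<beta> - 1)) (at 0)"
    using eventually_neq_at_within[of 0 0]
  proof eventually_elim
    case (elim x)
    then have "norm x > 0" by simp
    then have "norm x powr \<beta> = norm x powr (\<beta> - 1) * norm x"
      by (simp add: powr_diff)
    with elim bound[of x] show ?case by (simp add: field_simps)
  qed
  then have "((\<lambda>x. u x / norm x) \<longlongrightarrow> 0) (at 0)"
    by (rule Lim_null_comparison[OF _ lim])
  then have "((\<lambda>x. \<bar>u x / norm x\<bar>) \<longlongrightarrow> 0) (at 0)"
    by (rule tendsto_rabs_zero)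
  then show "((\<lambda>h. norm (u (0 + h) - u 0 - 0) / norm h) \<longlongrightarrow> 0) (at 0)"
    by (simp add: u0)
qed simp

lemma vanishes_on_free_boundary:
  fixes u :: "'a::topological_space \<Rightarrow> real"
  assumes S: "open S" and u: "continuous_on S u" and x: "x \<in> S" "0 \<le> u x"
    and fr: "x \<in> frontier {x \<in> S. 0 < u x}"
  shows "u x = 0"
proof -
  have "open (S \<inter> u -` {0<..})" using u S by (intro continuous_open_preimage) auto
  also have "S \<inter> u -` {0<..} = {x \<in> S. 0 < u x}" by auto
  finally show ?thesis using fr x by (auto simp: frontier_def interior_open)
qed

theorem theorem1p2:
  fixes \<alpha> m M :: real
  assumes "2 \<le> CARD('n::finite)" and "0 < \<alpha>" and "0 < m" and "m < 3"
  shows "\<exists>C>0. \<forall>(h :: real ^ 'n \<Rightarrow> real) (u :: real ^ 'n \<Rightarrow> real).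
    continuous_on (ball 0 1) h \<and> Linf_norm (ball 0 1) h < \<infinity> \<and> (\<forall>x\<in>ball 0 1. h x \<le> 0) \<and>
    continuous_on (ball 0 1) u \<and> Linf_norm (ball 0 1) u = ereal M \<and> (\<forall>x\<in>ball 0 1. 0 \<le> u x) \<and>
    viscosity_solution (ball 0 1) (\<lambda>x t. norm x powr \<alpha> * (max t 0) powr m + h x) u \<and>
    0 \<in> frontier {x \<in> ball 0 1. 0 < u x}
    \<longrightarrow>
    (\<forall>r. 0 < r \<and> r < 1/3 \<longrightarrow> (SUP x\<in>ball 0 r. u x) \<le> C * r powr ((4 + \<alpha>) / (3 - m))) \<and>
    (u has_derivative (\<lambda>_. 0)) (at 0)"
proof -
  define \<beta> where "\<beta> = (4 + \<alpha>) / (3 - m)"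
  have \<beta>: "1 < \<beta>" using assms by (simp add: \<beta>_def)
  define A where "A = max 1 (max (M * 3 powr \<beta>) ((54 * 3 powr (\<alpha> + \<beta> * m)) powr (1 / (3 - m))))"
  have A0: "0 < A" and A1: "M * 3 powr \<beta> \<le> A" by (auto simp: A_def)
  have "(54 * 3 powr (\<alpha> + \<beta> * m)) powr (1 / (3 - m)) \<le> A" by (simp add: A_def)
  then have "((54 * 3 powr (\<alpha> + \<beta> * m)) powr (1 / (3 - m))) powr (3 - m) \<le> A powr (3 - m)"
    using assms by (intro powr_mono2) auto
  then have A2: "54 * 3 powr (\<alpha> + \<beta> * m) \<le> A powr (3 - m)"
    using assms by (simp add: powr_powr)
  have main: "(\<forall>r. 0 < r \<and> r < 1/3 \<longrightarrow> (SUP x\<in>ball 0 r. u x) \<le> A * r powr \<beta>) \<and>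
      (u has_derivative (\<lambda>_. 0)) (at 0)"
    if h: "\<forall>x\<in>ball 0 1. h x \<le> 0"
      and cu: "continuous_on (ball 0 1) u" and uM: "Linf_norm (ball 0 1) u = ereal M"
      and u: "\<forall>x\<in>ball 0 1. 0 \<le> u x"
      and sol: "viscosity_solution (ball 0 1) (\<lambda>x t. norm x powr \<alpha> * (max t 0) powr m + h x) u"
      and fr: "0 \<in> frontier {x \<in> ball 0 1. 0 < u x}"
    for h u :: "real ^ 'n \<Rightarrow> real"
  proof -
    let ?F = "\<lambda>x t. norm x powr \<alpha> * (max t 0) powr m + h x"
    have u0: "u 0 = 0"
      by (rule vanishes_on_free_boundary[OF _ cu _ _ fr]) (use u in auto)
    have super: "viscosity_supersolution (ball 0 1) ?F u"
      using sol by (simp add: viscosity_solution_def)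
    have step: "u y ^ 3 \<le> 54 * r ^ 4 * ((3 * r) powr \<alpha> * B powr m)"
      if r: "0 < r" "3 * r < 1" and B: "0 \<le> B" "\<And>x. x \<in> ball 0 (3 * r) \<Longrightarrow> u x \<le> B"
        and y: "y \<in> ball 0 r" for r B y
    proof -
      have sub: "cball y (2 * r) \<subseteq> ball 0 (3 * r)"
      proof
        fix x assume "x \<in> cball y (2 * r)"
        then show "x \<in> ball 0 (3 * r)"
          using y dist_triangle[of 0 x y] by simp
      qed
      moreover have sub1: "ball 0 (3 * r) \<subseteq> ball (0 :: real ^ 'n) 1" using r by auto
      ultimately have sub2: "cball y (2 * r) \<subseteq> ball 0 1" by blast
      have "u y ^ 3 \<le> 27 / 8 * (2 * r) ^ 4 * ((3 * r) powr \<alpha> * B powr m)"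
      proof (rule supersolution_cone_bound[OF super sub2 _ _ _ u0])
        show "?F z (u z) \<le> (3 * r) powr \<alpha> * B powr m" if z: "z \<in> ball y (2 * r)" for z
        proof -
          have z3: "z \<in> ball 0 (3 * r)" using z sub ball_subset_cball by blast
          have "norm z powr \<alpha> * max (u z) 0 powr m \<le> (3 * r) powr \<alpha> * B powr m"
            using z3 B assms by (intro mult_mono powr_mono2) auto
          moreover have "h z \<le> 0" using h z3 sub1 by blast
          ultimately show ?thesis by simp
        qed
      qed (use r u y sub2 in auto)
      then show ?thesis by simp
    qed
    have M: "u x \<le> M" if "x \<in> ball 0 1" for x
      using le_Linf_norm_of_continuous[OF open_ball cu uM that] by simp
    have growth: "u x \<le> A * r powr \<beta>" if "0 < r" "r < 1" "x \<in> ball 0 r" for r x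
      unfolding \<beta>_def
      by (rule growth_iteration[where M = M and D = 54])
        (use assms M step A0 A1 A2 that in \<open>auto simp: \<beta>_def\<close>)
    have "(SUP x\<in>ball 0 r. u x) \<le> A * r powr \<beta>" if "0 < r" "r < 1/3" for r
      using that growth[of r] by (intro cSUP_least) auto
    moreover have "(u has_derivative (\<lambda>_. 0)) (at 0)"
    proof (rule has_derivative_zero_of_powr_bound[where u = u, OF u0 \<beta>])
      show "\<bar>u x\<bar> \<le> (A * 2 powr \<beta>) * norm x powr \<beta>" if "norm x < 1 / 2" for x
      proof (cases "x = 0")
        case False
        \<comment> \<open>The growth bound holds on open balls, so a radius larger than \<open>norm x\<close> is needed.\<close>
        from False have "u x \<le> A * (2 * norm x) powr \<beta>" using that by (intro growth) auto
        then show ?thesis using u that by (simp add: powr_mult)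
      qed (simp add: u0)
    qed simp
    ultimately show ?thesis by blast
  qed
  show ?thesis
    using A0 main unfolding \<beta>_def by (intro exI[of _ A]) blast
qed

end
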